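(* Let $\mathbf H=\langle H,\wedge,\vee,\Rightarrow,0,1\rangle$ be a Heyting algebra, let $\neg a:=a\Rightarrow 0$, and define $a\rightarrow b:=(a\Rightarrow b)\wedge(\neg a\Rightarrow\neg b)$ for $a,b\in H$. Then $\mathbb{C}(\mathbf H)=\langle H,\wedge,\vee,\rightarrow,0,1\rangle$ is a connexive Heyting algebra.
   Context: A connexive Heyting algebra is an algebra $\mathbf A=\langle A,\wedge,\vee,\rightarrow,0,1\rangle$ of type $\langle 2,2,2,0,0\rangle$ such that $\langle A,\wedge,\vee,0,1\rangle$ is a bounded distributive lattice with bottom $0$, top $1$ and lattice order $\le$, and, writing $\neg x:=x\rightarrow 0$ (in that algebra), the following hold for all elements: (C1) $(x\rightarrow y)\rightarrow((y\rightarrow z)\rightarrow(x\rightarrow z))=1$; (C2) $(x\rightarrow y)\rightarrow\neg(x\rightarrow\neg y)=1$; (C3) $x\wedge(x\rightarrow y)=x\wedge y$; (C4) $x\rightarrow y\le(z\wedge x)\rightarrow(z\wedge y)$; (C5) $x\rightarrow y\le(z\vee x)\rightarrow(z\vee y)$. *)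

theory Defs
  imports Main
begin

abbreviation (input) neg :: "('a \<Rightarrow> 'a \<Rightarrow> 'a) \<Rightarrow> 'a \<Rightarrow> 'a \<Rightarrow> 'a"
  where "neg imp zero x \<equiv> imp x zero"

text \<open>The carrier of an algebra is a whole (arbitrary) type. The order parameters come from the
  library class predicates, whose axioms force them to be the lattice order and its strict part.\<close>

locale heyting_algebra =
  bounded_lattice meet le lt join zero one
  for meet :: "'a \<Rightarrow> 'a \<Rightarrow> 'a" (infixl "\<sqinter>" 70)
    and le :: "'a \<Rightarrow> 'a \<Rightarrow> bool" (infix "\<sqsubseteq>" 50)
    and lt :: "'a \<Rightarrow> 'a \<Rightarrow> bool" (infix "\<sqsubset>" 50)
    and join :: "'a \<Rightarrow> 'a \<Rightarrow> 'a" (infixl "\<squnion>" 65)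
    and zero :: 'a ("\<zero>")
    and one :: 'a ("\<one>") +
  fixes imp :: "'a \<Rightarrow> 'a \<Rightarrow> 'a" (infixr "\<^bold>\<Rightarrow>" 60)
  assumes residuation: "x \<sqinter> y \<sqsubseteq> z \<longleftrightarrow> x \<sqsubseteq> (y \<^bold>\<Rightarrow> z)"

locale connexive_heyting_algebra =
  bounded_lattice meet le lt join zero one + distrib_lattice meet le lt join
  for meet :: "'a \<Rightarrow> 'a \<Rightarrow> 'a" (infixl "\<sqinter>" 70)
    and le :: "'a \<Rightarrow> 'a \<Rightarrow> bool" (infix "\<sqsubseteq>" 50)
    and lt :: "'a \<Rightarrow> 'a \<Rightarrow> bool" (infix "\<sqsubset>" 50)
    and join :: "'a \<Rightarrow> 'a \<Rightarrow> 'a" (infixl "\<squnion>" 65)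
    and zero :: 'a ("\<zero>")
    and one :: 'a ("\<one>") +
  fixes imp :: "'a \<Rightarrow> 'a \<Rightarrow> 'a" (infixr "\<^bold>\<rightarrow>" 60)
  assumes C1: "(x \<^bold>\<rightarrow> y) \<^bold>\<rightarrow> ((y \<^bold>\<rightarrow> z) \<^bold>\<rightarrow> (x \<^bold>\<rightarrow> z)) = \<one>"
    and C2: "(x \<^bold>\<rightarrow> y) \<^bold>\<rightarrow> neg imp \<zero> (x \<^bold>\<rightarrow> neg imp \<zero> y) = \<one>"
    and C3: "x \<sqinter> (x \<^bold>\<rightarrow> y) = x \<sqinter> y"
    and C4: "(x \<^bold>\<rightarrow> y) \<sqsubseteq> ((z \<sqinter> x) \<^bold>\<rightarrow> (z \<sqinter> y))"
    and C5: "(x \<^bold>\<rightarrow> y) \<sqsubseteq> ((z \<squnion> x) \<^bold>\<rightarrow> (z \<squnion> y))"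

definition connexive_imp ::
    "('a \<Rightarrow> 'a \<Rightarrow> 'a) \<Rightarrow> ('a \<Rightarrow> 'a \<Rightarrow> 'a) \<Rightarrow> 'a \<Rightarrow> 'a \<Rightarrow> 'a \<Rightarrow> 'a"
  where "connexive_imp meet imp zero a b =
    meet (imp a b) (imp (neg imp zero a) (neg imp zero b))"

end

theory Submission
  imports Defs
begin

text \<open>
  Inequalities are checked in Kripke style: \<open>m \<sqsubseteq> x \<^bold>\<Rightarrow> y\<close> holds iff every \<open>m' \<sqsubseteq> m\<close> below \<open>x\<close> lies
  below \<open>y\<close>. Since \<open>a \<^bold>\<rightarrow> b = \<one>\<close> means \<open>a \<sqsubseteq> b\<close> and \<open>\<not>a \<sqsubseteq> \<not>b\<close>, each of (C1) and (C2) splits into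
  a positive part, which is intuitionistic, and a part about negations. For the latter, an element
  that meets both \<open>a\<close> and \<open>\<not>a\<close> in \<open>\<zero>\<close> is itself \<open>\<zero>\<close>, so one may decide all variables classically,
  and there \<open>\<^bold>\<rightarrow>\<close> is the biconditional.
\<close>

context heyting_algebra
begin

abbreviation pseudocomplement :: "'a \<Rightarrow> 'a" ("\<sim> _" [80] 80)
  where "\<sim> x \<equiv> x \<^bold>\<Rightarrow> \<zero>"

abbreviation cimp :: "'a \<Rightarrow> 'a \<Rightarrow> 'a" (infixr "\<^bold>\<rightarrow>" 60)
  where "x \<^bold>\<rightarrow> y \<equiv> connexive_imp meet imp zero x y"

lemma le_imp_iff: "m \<sqsubseteq> (x \<^bold>\<Rightarrow> y) \<longleftrightarrow> (\<forall>m'. m' \<sqsubseteq> m \<longrightarrow> m' \<sqsubseteq> x \<longrightarrow> m' \<sqsubseteq> y)"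
  by (metis residuation inf_le1 inf_le2 le_inf_iff order_trans order_refl)

lemma imp_eq_one_iff: "(x \<^bold>\<Rightarrow> y) = \<one> \<longleftrightarrow> x \<sqsubseteq> y"
  by (metis residuation inf_top_left top_unique)

lemma le_zeroD: "m \<sqsubseteq> \<zero> \<Longrightarrow> m \<sqsubseteq> x"
  using bot_least order_trans by blast

text \<open>By \<open>residuation\<close>, meeting with \<open>x\<close> is a left adjoint and so
  preserves joins. The reverse inequality holds in every lattice, so this one suffices for
  distributivity.\<close>

lemma inf_sup_le: "x \<sqinter> (y \<squnion> z) \<sqsubseteq> (x \<sqinter> y) \<squnion> (x \<sqinter> z)"
proof -
  have "y \<squnion> z \<sqsubseteq> (x \<^bold>\<Rightarrow> (x \<sqinter> y) \<squnion> (x \<sqinter> z))"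
    by (rule sup_least; simp flip: residuation add: inf_commute)
  then show ?thesis
    by (simp flip: residuation add: inf_commute)
qed

lemma distributive: "class.distrib_lattice meet le lt join"
proof
  show "x \<squnion> (y \<sqinter> z) = (x \<squnion> y) \<sqinter> (x \<squnion> z)" for x y z
    by (rule distrib_imp1) (metis inf_sup_le order.antisym distrib_inf_le)
qed

text \<open>The case of elements below \<open>x\<close> yields
  \<open>m \<sqsubseteq> \<sim> x\<close>, so \<open>m\<close> is itself decided and the hypothesis
  applies to it.\<close>

lemma le_zero_if_decided:
  assumes "\<And>m'. m' \<sqsubseteq> m \<Longrightarrow> m' \<sqsubseteq> x \<or> m' \<sqsubseteq> \<sim> x \<Longrightarrow> m' \<sqsubseteq> \<zero>"
  shows "m \<sqsubseteq> \<zero>"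
  using assms le_imp_iff[of m x \<zero>] by blast

lemma le_neg_absurd: "m \<sqsubseteq> x \<Longrightarrow> m \<sqsubseteq> \<sim> x \<Longrightarrow> m \<sqsubseteq> \<zero>"
  using le_imp_iff order_refl by blast

lemma le_cimp_iff: "m \<sqsubseteq> (x \<^bold>\<rightarrow> y) \<longleftrightarrow> m \<sqsubseteq> (x \<^bold>\<Rightarrow> y) \<and> m \<sqsubseteq> (\<sim> x \<^bold>\<Rightarrow> \<sim> y)"
  by (simp add: connexive_imp_def)

text \<open>Both algebras thus have the same negation: \<open>\<sim> \<zero>\<close> is the top, so
  the second conjunct is trivial. This is why (C2) may be proved with \<open>\<sim>\<close>.\<close>

lemma cimp_zero: "(x \<^bold>\<rightarrow> \<zero>) = \<sim> x"
  by (simp add: connexive_imp_def imp_eq_one_iff[THEN iffD2] le_imp_iff)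

lemma cimp_eq_one: "x \<sqsubseteq> y \<Longrightarrow> \<sim> x \<sqsubseteq> \<sim> y \<Longrightarrow> (x \<^bold>\<rightarrow> y) = \<one>"
  by (simp add: connexive_imp_def imp_eq_one_iff)

text \<open>These are the four rows of the truth table of the biconditional.\<close>

lemma le_cimp_decided:
  "m \<sqsubseteq> x \<Longrightarrow> m \<sqsubseteq> y \<Longrightarrow> m \<sqsubseteq> (x \<^bold>\<rightarrow> y)"
  "m \<sqsubseteq> \<sim> x \<Longrightarrow> m \<sqsubseteq> \<sim> y \<Longrightarrow> m \<sqsubseteq> (x \<^bold>\<rightarrow> y)"
  "m \<sqsubseteq> x \<Longrightarrow> m \<sqsubseteq> \<sim> y \<Longrightarrow> m \<sqsubseteq> \<sim> (x \<^bold>\<rightarrow> y)"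
  "m \<sqsubseteq> \<sim> x \<Longrightarrow> m \<sqsubseteq> y \<Longrightarrow> m \<sqsubseteq> \<sim> (x \<^bold>\<rightarrow> y)"
  proof -
  show "m \<sqsubseteq> (x \<^bold>\<rightarrow> y)" if "m \<sqsubseteq> x" "m \<sqsubseteq> y"
    using that le_neg_absurd le_zeroD order_trans
    unfolding le_cimp_iff le_imp_iff[of m] by metis
  show "m \<sqsubseteq> (x \<^bold>\<rightarrow> y)" if "m \<sqsubseteq> \<sim> x" "m \<sqsubseteq> \<sim> y"
    using that le_neg_absurd le_zeroD order_trans
    unfolding le_cimp_iff le_imp_iff[of m "\<sim> x"] le_imp_iff[of m x y] by metis
  have "m' \<sqsubseteq> \<zero>" if "m' \<sqsubseteq> x" "m' \<sqsubseteq> \<sim> y" "m' \<sqsubseteq> (x \<^bold>\<rightarrow> y)" for m'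
    using that le_neg_absurd unfolding le_cimp_iff le_imp_iff[of m' x y] by blast
  then show "m \<sqsubseteq> \<sim> (x \<^bold>\<rightarrow> y)" if "m \<sqsubseteq> x" "m \<sqsubseteq> \<sim> y"
    using that order_trans unfolding le_imp_iff[of m "x \<^bold>\<rightarrow> y"] by blast
  \<comment> \<open>In this row the first conjunct of the connexive arrow gives nothing; the
    refutation comes from the conjunct about negations.\<close>
  have "m' \<sqsubseteq> \<zero>" if "m' \<sqsubseteq> \<sim> x" "m' \<sqsubseteq> y" "m' \<sqsubseteq> (x \<^bold>\<rightarrow> y)" for m'
    using that le_neg_absurd unfolding le_cimp_iff le_imp_iff[of m' "\<sim> x" "\<sim> y"] by blast
  then show "m \<sqsubseteq> \<sim> (x \<^bold>\<rightarrow> y)" if "m \<sqsubseteq> \<sim> x" "m \<sqsubseteq> y"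
    using that order_trans unfolding le_imp_iff[of m "x \<^bold>\<rightarrow> y"] by blast
qed

lemma neg_le_negI:
  assumes "\<And>m. m \<sqsubseteq> \<sim> x \<Longrightarrow> m \<sqsubseteq> y \<Longrightarrow> m \<sqsubseteq> \<zero>"
  shows "\<sim> x \<sqsubseteq> \<sim> y"
  using assms le_imp_iff by blast

lemma cimp_trans: "(x \<^bold>\<rightarrow> y) \<sqinter> (y \<^bold>\<rightarrow> z) \<sqsubseteq> (x \<^bold>\<rightarrow> z)"
proof -
  have "m \<sqsubseteq> (x \<^bold>\<rightarrow> z)" if "m \<sqsubseteq> (x \<^bold>\<rightarrow> y)" "m \<sqsubseteq> (y \<^bold>\<rightarrow> z)" for m
    using that unfolding le_cimp_iff le_imp_iff[of m] by blast
  then show ?thesis by simp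
qed

lemma cimp_C1: "(x \<^bold>\<rightarrow> y) \<^bold>\<rightarrow> ((y \<^bold>\<rightarrow> z) \<^bold>\<rightarrow> (x \<^bold>\<rightarrow> z)) = \<one>"
proof (rule cimp_eq_one)
  \<comment> \<open>Classically, \<open>x\<close> iff \<open>y\<close> and \<open>x\<close> iff
    \<open>z\<close> give \<open>y\<close> iff \<open>z\<close>, which refutes the first disjunct.
    Cancelling \<open>z\<close> in the nested biconditional leaves \<open>x\<close> iff
    \<open>y\<close>, which refutes the second. The first disjunct serves the inner negation
    conjunct, the second the outer one.\<close>
  have *: "m \<sqsubseteq> \<zero>"
    if "m \<sqsubseteq> (x \<^bold>\<rightarrow> y) \<and> m \<sqsubseteq> \<sim> (y \<^bold>\<rightarrow> z) \<and> m \<sqsubseteq> (x \<^bold>\<rightarrow> z)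
      \<or> m \<sqsubseteq> \<sim> (x \<^bold>\<rightarrow> y) \<and> m \<sqsubseteq> ((y \<^bold>\<rightarrow> z) \<^bold>\<rightarrow> (x \<^bold>\<rightarrow> z))" for m
  \<comment> \<open>The variables are decided one after another at ever smaller elements; earlier
    decisions persist downwards.\<close>
  proof (rule le_zero_if_decided[of m x], rule le_zero_if_decided[of _ y],
      rule le_zero_if_decided[of _ z])
    fix m1 m2 n
    assume below: "m1 \<sqsubseteq> m" "m2 \<sqsubseteq> m1" "n \<sqsubseteq> m2"
      and "m1 \<sqsubseteq> x \<or> m1 \<sqsubseteq> \<sim> x" "m2 \<sqsubseteq> y \<or> m2 \<sqsubseteq> \<sim> y"
      and z: "n \<sqsubseteq> z \<or> n \<sqsubseteq> \<sim> z"
    then have xy: "n \<sqsubseteq> x \<or> n \<sqsubseteq> \<sim> x" "n \<sqsubseteq> y \<or> n \<sqsubseteq> \<sim> y"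
      by (blast intro: order_trans)+
    have "n \<sqsubseteq> m"
      using below by (blast intro: order_trans)
    with that have "n \<sqsubseteq> (x \<^bold>\<rightarrow> y) \<and> n \<sqsubseteq> \<sim> (y \<^bold>\<rightarrow> z) \<and> n \<sqsubseteq> (x \<^bold>\<rightarrow> z)
        \<or> n \<sqsubseteq> \<sim> (x \<^bold>\<rightarrow> y) \<and> n \<sqsubseteq> ((y \<^bold>\<rightarrow> z) \<^bold>\<rightarrow> (x \<^bold>\<rightarrow> z))"
      by (blast intro: order_trans)
    with xy z show "n \<sqsubseteq> \<zero>"
      using le_cimp_decided[of n x y] le_cimp_decided[of n y z] le_cimp_decided[of n x z]
        le_cimp_decided[of n "y \<^bold>\<rightarrow> z" "x \<^bold>\<rightarrow> z"] le_neg_absurd[of n "x \<^bold>\<rightarrow> y"]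
        le_neg_absurd[of n "y \<^bold>\<rightarrow> z"] le_neg_absurd[of n "x \<^bold>\<rightarrow> z"]
        le_neg_absurd[of n "(y \<^bold>\<rightarrow> z) \<^bold>\<rightarrow> (x \<^bold>\<rightarrow> z)"]
      by argo
  qed
  show "(x \<^bold>\<rightarrow> y) \<sqsubseteq> ((y \<^bold>\<rightarrow> z) \<^bold>\<rightarrow> (x \<^bold>\<rightarrow> z))"
    unfolding le_cimp_iff[of _ "y \<^bold>\<rightarrow> z"]
  proof
    show "(x \<^bold>\<rightarrow> y) \<sqsubseteq> ((y \<^bold>\<rightarrow> z) \<^bold>\<Rightarrow> (x \<^bold>\<rightarrow> z))"
      using cimp_trans residuation by blast
    show "(x \<^bold>\<rightarrow> y) \<sqsubseteq> (\<sim> (y \<^bold>\<rightarrow> z) \<^bold>\<Rightarrow> \<sim> (x \<^bold>\<rightarrow> z))"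
      unfolding le_imp_iff[of "x \<^bold>\<rightarrow> y"] le_imp_iff[of _ "x \<^bold>\<rightarrow> z"]
      using * by (blast intro: order_trans)
  qed
  show "\<sim> (x \<^bold>\<rightarrow> y) \<sqsubseteq> \<sim> ((y \<^bold>\<rightarrow> z) \<^bold>\<rightarrow> (x \<^bold>\<rightarrow> z))"
    using * by (blast intro: neg_le_negI)
qed

lemma cimp_C2: "(x \<^bold>\<rightarrow> y) \<^bold>\<rightarrow> \<sim> (x \<^bold>\<rightarrow> \<sim> y) = \<one>"
proof (rule cimp_eq_one)
  \<comment> \<open>Once \<open>x\<close> and \<open>y\<close> are decided, exactly one of
    \<open>x\<close> iff \<open>y\<close> and \<open>x\<close> iff not \<open>y\<close> holds. That
    they exclude each other gives the positive part, that one of them holds the part about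
    negations.\<close>
  have *: "m \<sqsubseteq> \<zero>"
    if "m \<sqsubseteq> (x \<^bold>\<rightarrow> y) \<and> m \<sqsubseteq> (x \<^bold>\<rightarrow> \<sim> y)
      \<or> m \<sqsubseteq> \<sim> (x \<^bold>\<rightarrow> y) \<and> m \<sqsubseteq> \<sim> (x \<^bold>\<rightarrow> \<sim> y)" for m
  proof (rule le_zero_if_decided[of m x], rule le_zero_if_decided[of _ y])
    fix m1 n
    assume below: "m1 \<sqsubseteq> m" "n \<sqsubseteq> m1"
      and "m1 \<sqsubseteq> x \<or> m1 \<sqsubseteq> \<sim> x"
      and y: "n \<sqsubseteq> y \<or> n \<sqsubseteq> \<sim> y"
    then have x: "n \<sqsubseteq> x \<or> n \<sqsubseteq> \<sim> x"
      by (blast intro: order_trans)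
    \<comment> \<open>The truth table for \<open>x\<close> and \<open>\<sim> y\<close> needs
      \<open>\<sim> y\<close> decided, hence \<open>\<sim> \<sim> y\<close> where \<open>y\<close>
      holds.\<close>
    have dneg: "n \<sqsubseteq> \<sim> \<sim> y" if "n \<sqsubseteq> y"
      using that le_imp_iff[of n "\<sim> y"] le_neg_absurd by (blast intro: order_trans)
    have "n \<sqsubseteq> m"
      using below by (blast intro: order_trans)
    with that have "n \<sqsubseteq> (x \<^bold>\<rightarrow> y) \<and> n \<sqsubseteq> (x \<^bold>\<rightarrow> \<sim> y)
        \<or> n \<sqsubseteq> \<sim> (x \<^bold>\<rightarrow> y) \<and> n \<sqsubseteq> \<sim> (x \<^bold>\<rightarrow> \<sim> y)"
      by (blast intro: order_trans)
    with x y dneg show "n \<sqsubseteq> \<zero>"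
      using le_cimp_decided[of n x y] le_cimp_decided[of n x "\<sim> y"]
        le_neg_absurd[of n "x \<^bold>\<rightarrow> y"] le_neg_absurd[of n "x \<^bold>\<rightarrow> \<sim> y"]
      by argo
  qed
  show "(x \<^bold>\<rightarrow> y) \<sqsubseteq> \<sim> (x \<^bold>\<rightarrow> \<sim> y)"
    unfolding le_imp_iff[of "x \<^bold>\<rightarrow> y"] using * by blast
  show "\<sim> (x \<^bold>\<rightarrow> y) \<sqsubseteq> \<sim> \<sim> (x \<^bold>\<rightarrow> \<sim> y)"
    using * by (blast intro: neg_le_negI)
qed

lemma cimp_C3: "x \<sqinter> (x \<^bold>\<rightarrow> y) = x \<sqinter> y"
proof (rule order.antisym)
  have "m \<sqsubseteq> y" if "m \<sqsubseteq> x" "m \<sqsubseteq> (x \<^bold>\<rightarrow> y)" for m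
    using that le_cimp_iff le_imp_iff order_refl by blast
  then show "x \<sqinter> (x \<^bold>\<rightarrow> y) \<sqsubseteq> x \<sqinter> y" by simp
  show "x \<sqinter> y \<sqsubseteq> x \<sqinter> (x \<^bold>\<rightarrow> y)"
    by (simp add: le_cimp_decided(1))
qed

lemma cimp_C4: "(x \<^bold>\<rightarrow> y) \<sqsubseteq> ((z \<sqinter> x) \<^bold>\<rightarrow> (z \<sqinter> y))"
  unfolding le_cimp_iff[of _ "z \<sqinter> x"]
proof
  show "(x \<^bold>\<rightarrow> y) \<sqsubseteq> (z \<sqinter> x \<^bold>\<Rightarrow> z \<sqinter> y)"
    using le_cimp_iff[of "x \<^bold>\<rightarrow> y" x y]
    unfolding le_imp_iff[of "x \<^bold>\<rightarrow> y"] le_inf_iff by blast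
  \<comment> \<open>This moves \<open>z\<close> out of the negation: the conjunct about
    \<open>\<sim> x\<close> and \<open>\<sim> y\<close> is then applied at
    \<open>m \<sqinter> z\<close> instead of \<open>m\<close>.\<close>
  have neg_inf: "m \<sqsubseteq> \<sim> (z \<sqinter> a) \<longleftrightarrow> m \<sqinter> z \<sqsubseteq> \<sim> a" for m a
    by (simp flip: residuation add: inf_assoc)
  have "(x \<^bold>\<rightarrow> y) \<sqsubseteq> (\<sim> x \<^bold>\<Rightarrow> \<sim> y)"
    using le_cimp_iff order_refl by blast
  then show "(x \<^bold>\<rightarrow> y) \<sqsubseteq> (\<sim> (z \<sqinter> x) \<^bold>\<Rightarrow> \<sim> (z \<sqinter> y))"
    unfolding le_imp_iff[of "x \<^bold>\<rightarrow> y"] neg_inf by (blast intro: le_infI1)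
qed

lemma cimp_C5: "(x \<^bold>\<rightarrow> y) \<sqsubseteq> ((z \<squnion> x) \<^bold>\<rightarrow> (z \<squnion> y))"
  unfolding le_cimp_iff[of _ "z \<squnion> x"]
proof
  \<comment> \<open>With the join on the left, \<open>sup_least\<close> splits into cases:
    \<open>z\<close> is immediate, and \<open>x\<close> is modus ponens in the form
    \<open>cimp_C3\<close>.\<close>
  have "z \<squnion> x \<sqsubseteq> ((x \<^bold>\<rightarrow> y) \<^bold>\<Rightarrow> z \<squnion> y)"
    by (rule sup_least) (simp_all flip: residuation add: cimp_C3 le_infI1 le_infI2)
  then show "(x \<^bold>\<rightarrow> y) \<sqsubseteq> (z \<squnion> x \<^bold>\<Rightarrow> z \<squnion> y)"
    by (simp flip: residuation add: inf_commute)
  \<comment> \<open>Negation turns the joins into meets with the common part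
    \<open>\<sim> z\<close>, leaving only the step from \<open>\<sim> x\<close> to
    \<open>\<sim> y\<close>.\<close>
  have neg_sup: "m \<sqsubseteq> \<sim> (a \<squnion> b) \<longleftrightarrow> m \<sqsubseteq> \<sim> a \<and> m \<sqsubseteq> \<sim> b" for m a b
    by (metis residuation inf_commute le_sup_iff)
  show "(x \<^bold>\<rightarrow> y) \<sqsubseteq> (\<sim> (z \<squnion> x) \<^bold>\<Rightarrow> \<sim> (z \<squnion> y))"
    using le_cimp_iff[of "x \<^bold>\<rightarrow> y" x y]
    unfolding le_imp_iff[of "x \<^bold>\<rightarrow> y"] neg_sup by blast
qed

end

theorem theorem3p14:
  fixes meet join imp :: "'a \<Rightarrow> 'a \<Rightarrow> 'a"
    and le lt :: "'a \<Rightarrow> 'a \<Rightarrow> bool"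
    and zero one :: 'a
  assumes "heyting_algebra meet le lt join zero one imp"
  shows "connexive_heyting_algebra meet le lt join zero one (connexive_imp meet imp zero)"
proof -
  interpret heyting_algebra meet le lt join zero one imp by fact
  interpret distrib_lattice meet le lt join by (rule distributive)
  show ?thesis
    by unfold_locales (simp_all only: cimp_zero cimp_C1 cimp_C2 cimp_C3 cimp_C4 cimp_C5)
qed

end
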